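(* Let $G=(V,E)$ be a finite connected multigraph without self-loops and with at least one edge, with set of spanning trees $\Gamma_G$. Then the extremal density $\eta^*$ for $\mathrm{Mod}_2(\widehat{\Gamma_G})$ is the unique solution $\eta$ of the fairest edge usage (FEU) problem: minimize $\mathrm{Var}(\eta)$ over $\eta\in\mathbb{R}^E$ subject to $\eta(e)=\mathbb{P}_\mu(e\in\underline{\gamma})$ for all $e\in E$ for some $\mu\in\mathcal{P}(\Gamma_G)$.
   Context: $\Gamma_G$ is the set of spanning trees of $G$, regarded as subsets of $E$; $\mathcal{P}(\Gamma_G)$ is the set of probability mass functions on $\Gamma_G$; $\mathbb{P}_\mu(e\in\underline{\gamma})=\sum_{\gamma\in\Gamma_G,\,e\in\gamma}\mu(\gamma)$. For $\xi\in\mathbb{R}^E$: $\mathbb{E}(\xi)=\frac{1}{|E|}\sum_{e\in E}\xi(e)$ and $\mathrm{Var}(\xi)=\mathbb{E}(\xi^2)-(\mathbb{E}(\xi))^2$, with $\xi^2$ taken element-wise. $\mathrm{Adm}(\Gamma_G)=\{\rho\in\mathbb{R}^E_{\ge0}:\sum_{e\in\gamma}\rho(e)\ge1\ \forall\gamma\in\Gamma_G\}$; the Fulkerson dual family $\widehat{\Gamma_G}\subset\mathbb{R}^E_{\ge0}$ is the set of extreme points of $\mathrm{Adm}(\Gamma_G)$; $\mathrm{Adm}(\widehat{\Gamma_G})=\{\eta\in\mathbb{R}^E_{\ge0}:\sum_{e\in E}\hat\gamma(e)\eta(e)\ge1\ \forall\hat\gamma\in\widehat{\Gamma_G}\}$;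 $\mathrm{Mod}_2(\widehat{\Gamma_G})=\min_{\eta\in\mathrm{Adm}(\widehat{\Gamma_G})}\sum_{e\in E}\eta(e)^2$, and the extremal density $\eta^*$ is the unique minimizer. *)

theory Defs
  imports "HOL-Analysis.Analysis" "HOL-Probability.Probability_Mass_Function"
begin

(* A finite loopless multigraph: the vertex set is the finite type 'v, the edge set is the
   finite type 'e (nonempty, like every type, so there is at least one edge), and "ends e" is
   the set of the two endpoints of e. Distinct edges may have the same endpoints, i.e. be
   parallel. Vectors in R^E are elements of real^'e. *)
definition loopless_multigraph :: "('e::finite \<Rightarrow> 'v::finite set) \<Rightarrow> bool" where
  "loopless_multigraph ends \<longleftrightarrow> (\<forall>e. card (ends e) = 2)"

definition adjacent_via :: "('e::finite \<Rightarrow> 'v::finite set) \<Rightarrow> 'e set \<Rightarrow> 'v \<Rightarrow> 'v \<Rightarrow> bool" where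
  "adjacent_via ends T u v \<longleftrightarrow> (\<exists>e\<in>T. ends e = {u, v})"

(* The subgraph (V, T) on all vertices is connected. *)
definition connects :: "('e::finite \<Rightarrow> 'v::finite set) \<Rightarrow> 'e set \<Rightarrow> bool" where
  "connects ends T \<longleftrightarrow> (\<forall>u v. (adjacent_via ends T)\<^sup>*\<^sup>* u v)"

(* vs lists the distinct vertices and es the distinct edges of the cycle
   vs!0, es!0, vs!1, es!1, ..., vs!0; two parallel edges form a cycle of length 2. *)
definition is_cycle :: "('e::finite \<Rightarrow> 'v::finite set) \<Rightarrow> 'v list \<Rightarrow> 'e list \<Rightarrow> bool" where
  "is_cycle ends vs es \<longleftrightarrow>
     es \<noteq> [] \<and> length vs = length es \<and> distinct vs \<and> distinct es \<and>
     (\<forall>i<length es. ends (es ! i) = {vs ! i, vs ! (Suc i mod length es)})"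

definition acyclic_edges :: "('e::finite \<Rightarrow> 'v::finite set) \<Rightarrow> 'e set \<Rightarrow> bool" where
  "acyclic_edges ends T \<longleftrightarrow> \<not> (\<exists>vs es. set es \<subseteq> T \<and> is_cycle ends vs es)"

definition spanning_trees :: "('e::finite \<Rightarrow> 'v::finite set) \<Rightarrow> 'e set set" where
  "spanning_trees ends = {T. connects ends T \<and> acyclic_edges ends T}"

(* The probability mass functions on \<Gamma>, as pmfs on the whole type supported in \<Gamma>. *)
definition pmfs_on :: "'a set \<Rightarrow> 'a pmf set" where
  "pmfs_on \<Gamma> = {\<mu>. set_pmf \<mu> \<subseteq> \<Gamma>}"

definition edge_usage_prob :: "'e::finite set set \<Rightarrow> 'e set pmf \<Rightarrow> 'e \<Rightarrow> real" where
  "edge_usage_prob \<Gamma> \<mu> e = (\<Sum>\<gamma> | \<gamma> \<in> \<Gamma> \<and> e \<in> \<gamma>. pmf \<mu> \<gamma>)"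

(* Mean and variance with respect to the uniform distribution on the edges. *)
definition edge_mean :: "real ^ 'e::finite \<Rightarrow> real" where
  "edge_mean \<xi> = (\<Sum>e\<in>UNIV. \<xi> $ e) / real CARD('e)"

definition edge_var :: "real ^ 'e::finite \<Rightarrow> real" where
  "edge_var \<xi> = edge_mean (\<chi> e. (\<xi> $ e)\<^sup>2) - (edge_mean \<xi>)\<^sup>2"

definition adm_sets :: "'e::finite set set \<Rightarrow> (real ^ 'e) set" where
  "adm_sets \<Gamma> = {\<rho>. (\<forall>e. 0 \<le> \<rho> $ e) \<and> (\<forall>\<gamma>\<in>\<Gamma>. 1 \<le> (\<Sum>e\<in>\<gamma>. \<rho> $ e))}"

definition fulkerson_dual :: "'e::finite set set \<Rightarrow> (real ^ 'e) set" where
  "fulkerson_dual \<Gamma> = {\<rho>. \<rho> extreme_point_of adm_sets \<Gamma>}"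

(* Admissibility for a family of nonnegative usage vectors instead of a family of edge sets. *)
definition adm_vecs :: "(real ^ 'e::finite) set \<Rightarrow> (real ^ 'e) set" where
  "adm_vecs F = {\<eta>. (\<forall>e. 0 \<le> \<eta> $ e) \<and> (\<forall>\<gamma>\<in>F. 1 \<le> (\<Sum>e\<in>UNIV. \<gamma> $ e * \<eta> $ e))}"

(* \<eta> attains the minimum defining the 2-modulus of F. *)
definition is_extremal_density :: "(real ^ 'e::finite) set \<Rightarrow> real ^ 'e \<Rightarrow> bool" where
  "is_extremal_density F \<eta> \<longleftrightarrow>
     is_arg_min (\<lambda>\<eta>. \<Sum>e\<in>UNIV. (\<eta> $ e)\<^sup>2) (\<lambda>\<eta>. \<eta> \<in> adm_vecs F) \<eta>"

definition feu_feasible :: "'e::finite set set \<Rightarrow> real ^ 'e \<Rightarrow> bool" where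
  "feu_feasible \<Gamma> \<eta> \<longleftrightarrow> (\<exists>\<mu>\<in>pmfs_on \<Gamma>. \<forall>e. \<eta> $ e = edge_usage_prob \<Gamma> \<mu> e)"

definition is_feu_solution :: "'e::finite set set \<Rightarrow> real ^ 'e \<Rightarrow> bool" where
  "is_feu_solution \<Gamma> \<eta> \<longleftrightarrow> is_arg_min edge_var (feu_feasible \<Gamma>) \<eta>"

end

theory Submission
  imports Defs
begin

text \<open>Let \<open>P\<close> be the convex hull of the indicator vectors of the spanning trees. The feasible
  vectors of the FEU problem are exactly the points of \<open>P\<close>
  (\<open>feu_feasible_iff_usage_polytope\<close>). All spanning trees have the same number of edges
  (\<open>card_spanning_trees_eq\<close>), so all points of \<open>P\<close> have the same mean, and on \<open>P\<close> the variance
  is an increasing affine function of the squared Euclidean norm. Hence the FEU solution is the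
  point of least norm in the nonempty compact convex set \<open>P\<close>, which exists and is unique.

  On the side of the modulus, blocking duality says that the densities admissible for the
  Fulkerson dual family form the dominant of \<open>P\<close>: every point of \<open>P\<close> is admissible
  (\<open>usage_polytope_subset_adm_vecs\<close>), and every admissible density lies coordinatewise above a
  point of \<open>P\<close> (\<open>adm_vecs_fulkerson_dual_dominates\<close>). As \<open>P\<close> lies in the nonnegative orthant,
  passing to a point of \<open>P\<close> below an admissible density strictly decreases the energy unless the
  density was already in \<open>P\<close>. So the minimum energy over the dominant is attained only in \<open>P\<close>, at
  the same point of least norm.

  The duality has two steps. Constraints from extreme points of the polyhedron of densities
  admissible for the trees imply the constraints from all of its points, since a positive linear
  functional on it attains its minimum at an extreme point. Given all these constraints, a
  hyperplane separating \<open>P\<close> from the orthant below a density would yield a violated one. Equality of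
  the cardinalities is a comparison of an independent set with a spanning set in a real vector
  space: acyclic edge sets have linearly independent oriented incidence vectors, and connecting
  edge sets have incidence vectors whose span contains all of them.\<close>

section \<open>Paths, cycles and connectivity\<close>

lemma adjacent_via_sym: "adjacent_via ends T u v \<Longrightarrow> adjacent_via ends T v u"
  unfolding adjacent_via_def by (auto simp: insert_commute)

lemma reachable_sym:
  "(adjacent_via ends T)\<^sup>*\<^sup>* u v \<Longrightarrow> (adjacent_via ends T)\<^sup>*\<^sup>* v u"
  by (rule sympD[OF symp_rtranclp]) (auto intro: sympI adjacent_via_sym)

definition is_simple_path ::
    "('e::finite \<Rightarrow> 'v::finite set) \<Rightarrow> 'e set \<Rightarrow> 'v \<Rightarrow> 'v \<Rightarrow> 'v list \<Rightarrow> 'e list \<Rightarrow> bool" where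
  "is_simple_path ends T u v vs es \<longleftrightarrow>
     length vs = Suc (length es) \<and> distinct vs \<and> set es \<subseteq> T \<and>
     vs ! 0 = u \<and> vs ! length es = v \<and>
     (\<forall>i<length es. ends (es ! i) = {vs ! i, vs ! Suc i})"

lemma simple_path_distinct_edges:
  assumes "is_simple_path ends T u v vs es"
  shows "distinct es"
proof -
  have "es ! i \<noteq> es ! j" if "i < j" "j < length es" for i j
  proof
    assume eq: "es ! i = es ! j"
    have "{vs ! i, vs ! Suc i} = {vs ! j, vs ! Suc j}"
      using assms that eq unfolding is_simple_path_def by (metis order.strict_trans)
    then have "vs ! i = vs ! j \<or> vs ! i = vs ! Suc j"
      by blast
    moreover have "distinct vs" "length vs = Suc (length es)"
      using assms unfolding is_simple_path_def by auto
    ultimately show False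
      using that by (auto simp: nth_eq_iff_index_eq)
  qed
  then show ?thesis
    unfolding distinct_conv_nth by (metis nat_neq_iff)
qed

text \<open>A walk is grown one edge at a time; when the new endpoint has been visited before, cutting
  back to that visit keeps the vertices distinct.\<close>
lemma reachable_imp_simple_path:
  assumes "(adjacent_via ends T)\<^sup>*\<^sup>* u v"
  shows "\<exists>vs es. is_simple_path ends T u v vs es"
  using assms
proof (induction rule: rtranclp_induct)
  case base
  have "is_simple_path ends T u u [u] []"
    by (simp add: is_simple_path_def)
  then show ?case by blast
next
  case (step v w)
  then obtain vs es where p: "is_simple_path ends T u v vs es"
    by blast
  obtain d where d: "d \<in> T" "ends d = {v, w}"
    using step.hyps unfolding adjacent_via_def by blast
  show ?case
  proof (cases "w \<in> set vs")
    case True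
    then obtain k where "k < length vs" "vs ! k = w"
      by (auto simp: in_set_conv_nth)
    then have k: "k \<le> length es" "vs ! k = w"
      using p unfolding is_simple_path_def by auto
    have "is_simple_path ends T u w (take (Suc k) vs) (take k es)"
      using p k set_take_subset[of k es]
      unfolding is_simple_path_def by (auto simp: min_absorb1 min_absorb2)
    then show ?thesis by blast
  next
    case False
    have "is_simple_path ends T u w (vs @ [w]) (es @ [d])"
      using p d False unfolding is_simple_path_def
      by (auto simp: nth_append less_Suc_eq)
    then show ?thesis by blast
  qed
qed

text \<open>The edge \<open>d\<close> is required outside \<open>T\<close> since going along an edge and back is not a cycle.\<close>
lemma simple_path_close_cycle:
  assumes p: "is_simple_path ends T u v vs es" and d: "d \<notin> T" "ends d = {u, v}"
  shows "is_cycle ends vs (es @ [d])"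
proof -
  have "distinct (es @ [d])"
    using simple_path_distinct_edges[OF p] p d(1) unfolding is_simple_path_def by auto
  moreover have "ends ((es @ [d]) ! i) = {vs ! i, vs ! (Suc i mod length (es @ [d]))}"
    if "i < length (es @ [d])" for i
  proof (cases "i = length es")
    case True
    then show ?thesis
      using p d(2) unfolding is_simple_path_def by (simp add: insert_commute)
  next
    case False
    then have "i < length es" "Suc i mod length (es @ [d]) = Suc i"
      using that by auto
    then show ?thesis
      using p unfolding is_simple_path_def by (simp add: nth_append)
  qed
  ultimately show ?thesis
    using p unfolding is_cycle_def is_simple_path_def by simp
qed

lemma acyclic_edges_mono: "acyclic_edges ends T \<Longrightarrow> S \<subseteq> T \<Longrightarrow> acyclic_edges ends S"
  unfolding acyclic_edges_def by blast

lemma acyclic_insert_not_reachable: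
  assumes "acyclic_edges ends (insert d T)" "d \<notin> T" "ends d = {u, v}"
  shows "\<not> (adjacent_via ends T)\<^sup>*\<^sup>* u v"
proof
  assume "(adjacent_via ends T)\<^sup>*\<^sup>* u v"
  then obtain vs es where p: "is_simple_path ends T u v vs es"
    using reachable_imp_simple_path by blast
  have "is_cycle ends vs (es @ [d])"
    using simple_path_close_cycle[OF p assms(2,3)] .
  moreover have "set (es @ [d]) \<subseteq> insert d T"
    using p unfolding is_simple_path_def by auto
  ultimately show False
    using assms(1) unfolding acyclic_edges_def by blast
qed

text \<open>The rest of a cycle is a detour around any of its edges, so that edge can be dropped.\<close>
lemma connects_delete_cycle_edge:
  assumes loopless: "loopless_multigraph ends" and conn: "connects ends T"
    and cyc: "is_cycle ends vs es" "set es \<subseteq> T"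
  shows "connects ends (T - {es ! 0})"
proof -
  let ?S = "T - {es ! 0}"
  let ?R = "(adjacent_via ends ?S)\<^sup>*\<^sup>*"
  have len: "length vs = length es" and ne: "es \<noteq> []" and dist: "distinct es"
    and nth: "\<And>i. i < length es \<Longrightarrow> ends (es ! i) = {vs ! i, vs ! (Suc i mod length es)}"
    using cyc(1) unfolding is_cycle_def by auto
  have two: "2 \<le> length es"
  proof (rule ccontr)
    assume "\<not> 2 \<le> length es"
    moreover have "0 < length es"
      using ne by simp
    ultimately have "length es = 1"
      by linarith
    then have "card (ends (es ! 0)) = 1"
      using nth[of 0] by simp
    then show False
      using loopless unfolding loopless_multigraph_def by simp
  qed
  have adj: "adjacent_via ends ?S (vs ! i) (vs ! (Suc i mod length es))"
    if "0 < i" "i < length es" for i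
  proof -
    have "es ! i \<noteq> es ! 0"
      using dist that by (subst nth_eq_iff_index_eq) auto
    then have "es ! i \<in> ?S"
      using that cyc(2) nth_mem by blast
    then show ?thesis
      using nth[OF that(2)] unfolding adjacent_via_def by blast
  qed
  have detour: "?R (vs ! 1) (vs ! j)" if "1 \<le> j" "j < length es" for j
    using that
  proof (induction j rule: dec_induct)
    case (step j)
    then have "adjacent_via ends ?S (vs ! j) (vs ! Suc j)"
      using adj[of j] by simp
    then show ?case
      using step by (auto intro: rtranclp.rtrancl_into_rtrancl)
  qed simp
  have "adjacent_via ends ?S (vs ! (length es - 1)) (vs ! 0)"
    using adj[of "length es - 1"] two by (cases "length es") auto
  moreover have "?R (vs ! 1) (vs ! (length es - 1))"
    using two by (intro detour) auto
  ultimately have "?R (vs ! 1) (vs ! 0)"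
    by (simp add: rtranclp.rtrancl_into_rtrancl)
  then have ends_joined: "?R (vs ! 1) (vs ! 0)" "?R (vs ! 0) (vs ! 1)"
    by (auto dest: reachable_sym)
  have step: "?R u v" if uv: "adjacent_via ends T u v" for u v
  proof -
    obtain d where d: "d \<in> T" "ends d = {u, v}"
      using uv unfolding adjacent_via_def by blast
    show ?thesis
    proof (cases "d = es ! 0")
      case True
      then have "{u, v} = {vs ! 0, vs ! 1}"
        using nth[of 0] d(2) two ne by simp
      then show ?thesis
        using ends_joined by (auto simp: doubleton_eq_iff)
    next
      case False
      then have "adjacent_via ends ?S u v"
        using d unfolding adjacent_via_def by blast
      then show ?thesis by blast
    qed
  qed
  have "?R u v" if "(adjacent_via ends T)\<^sup>*\<^sup>* u v" for u v
    using that by (induction rule: rtranclp_induct) (auto intro: rtranclp_trans dest: step)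
  then show ?thesis
    using conn unfolding connects_def by blast
qed

text \<open>A connecting edge set of least size contains no cycle, as it could be made smaller by
  breaking the cycle.\<close>
lemma spanning_trees_nonempty:
  assumes "loopless_multigraph ends" "connects ends UNIV"
  shows "spanning_trees ends \<noteq> {}"
proof -
  obtain T where T: "connects ends T" and min: "\<And>S. connects ends S \<Longrightarrow> card T \<le> card S"
    using assms(2) by (metis ex_has_least_nat)
  have "acyclic_edges ends T"
    unfolding acyclic_edges_def
  proof (intro notI, elim exE conjE)
    fix vs es
    assume c: "set es \<subseteq> T" "is_cycle ends vs es"
    then have "es ! 0 \<in> T"
      by (auto simp: is_cycle_def)
    then have "card (T - {es ! 0}) < card T"
      by (intro card_Diff1_less) auto
    then show False
      using min[OF connects_delete_cycle_edge[OF assms(1) T c(2,1)]] by simp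
  qed
  then show ?thesis
    using T unfolding spanning_trees_def by blast
qed

section \<open>Spanning trees have equally many edges\<close>

text \<open>The columns of an oriented incidence matrix. The orientation of each edge is left open: only
  spans and independence matter below, and these do not see signs.\<close>
definition is_incidence ::
    "('e::finite \<Rightarrow> 'v::finite set) \<Rightarrow> ('e \<Rightarrow> real ^ 'v) \<Rightarrow> bool" where
  "is_incidence ends x \<longleftrightarrow>
     (\<forall>e. \<exists>u v. u \<noteq> v \<and> ends e = {u, v} \<and> x e = axis u 1 - axis v 1)"

lemma incidence_exists:
  assumes "loopless_multigraph ends"
  shows "\<exists>x. is_incidence ends x"
proof -
  have "\<exists>y u v. u \<noteq> v \<and> ends e = {u, v} \<and> y = axis u (1::real) - axis v 1" for e
  proof -
    have "card (ends e) = 2"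
      using assms unfolding loopless_multigraph_def by blast
    then show ?thesis
      by (auto simp: card_2_iff)
  qed
  then show ?thesis
    unfolding is_incidence_def by (intro choice) blast
qed

text \<open>Along a walk the vectors of the traversed edges, suitably signed, telescope.\<close>
lemma axis_diff_in_span_incidence:
  assumes x: "is_incidence ends x" and "(adjacent_via ends T)\<^sup>*\<^sup>* u v"
  shows "axis u 1 - axis v 1 \<in> span (x ` T)"
  using assms(2)
proof (induction rule: rtranclp_induct)
  case base
  show ?case by (simp add: span_zero)
next
  case (step v w)
  obtain d where d: "d \<in> T" "ends d = {v, w}"
    using step.hyps unfolding adjacent_via_def by blast
  obtain a b where ab: "ends d = {a, b}" "x d = axis a 1 - axis b 1"
    using x unfolding is_incidence_def by metis
  have "x d \<in> span (x ` T)"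
    using d(1) by (intro span_base) auto
  moreover have "axis v 1 - axis w 1 = x d \<or> axis v 1 - axis w 1 = - x d"
    using d(2) ab by (auto simp: doubleton_eq_iff)
  ultimately have "axis v 1 - axis w 1 \<in> span (x ` T)"
    by (auto intro: span_neg simp del: minus_diff_eq)
  from span_add[OF step.IH this] show ?case by simp
qed

text \<open>Summing the coordinates over one component of the forest annihilates the vectors of all
  edges in the forest, but not the vector of an edge that leaves the component.\<close>
lemma incidence_notin_span:
  assumes x: "is_incidence ends x" and ac: "acyclic_edges ends (insert d T)" and d: "d \<notin> T"
  shows "x d \<notin> span (x ` T)"
proof
  assume mem: "x d \<in> span (x ` T)"
  obtain u v where uv: "u \<noteq> v" "ends d = {u, v}" "x d = axis u 1 - axis v 1"
    using x unfolding is_incidence_def by metis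
  define C where "C = {w. (adjacent_via ends T)\<^sup>*\<^sup>* u w}"
  define f :: "real ^ 'b \<Rightarrow> real" where "f y = (\<Sum>w\<in>C. y $ w)" for y
  have lin: "linear f"
    unfolding f_def by (intro linearI) (auto simp: sum.distrib sum_distrib_left)
  have f_axis: "f (axis a 1) = of_bool (a \<in> C)" for a
  proof -
    have "f (axis a 1) = (\<Sum>w\<in>C. if w = a then 1 else 0)"
      unfolding f_def by (intro sum.cong) (auto simp: axis_def)
    then show ?thesis by (simp add: sum.delta)
  qed
  have "f y = 0" if y: "y \<in> x ` T" for y
  proof -
    obtain t where t: "t \<in> T" "y = x t"
      using y by blast
    obtain a b where ab: "ends t = {a, b}" "x t = axis a 1 - axis b 1"
      using x unfolding is_incidence_def by metis
    have "adjacent_via ends T a b" "adjacent_via ends T b a"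
      using t(1) ab(1) unfolding adjacent_via_def by (auto simp: insert_commute)
    then have "a \<in> C \<longleftrightarrow> b \<in> C"
      unfolding C_def by (auto intro: rtranclp.rtrancl_into_rtrancl)
    then show ?thesis
      using t ab by (simp add: linear_diff[OF lin] f_axis)
  qed
  then have "f (x d) = 0"
    using linear_eq_0_on_span[OF lin _ mem] by blast
  then have "v \<in> C"
    using uv(3) by (simp add: linear_diff[OF lin] f_axis C_def split: if_splits)
  then show False
    using acyclic_insert_not_reachable[OF ac d uv(2)] unfolding C_def by simp
qed

lemma acyclic_imp_independent_incidence:
  assumes x: "is_incidence ends x" and "acyclic_edges ends T"
  shows "independent (x ` T) \<and> inj_on x T"
  using finite[of T] assms(2)
proof (induction T rule: finite_induct)
  case empty
  show ?case by (simp add: independent_empty)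
next
  case (insert d T)
  have "independent (x ` T)" "inj_on x T"
    using insert.IH acyclic_edges_mono[OF insert.prems] by auto
  moreover have "x d \<notin> span (x ` T)"
    using incidence_notin_span[OF x insert.prems insert.hyps(2)] .
  ultimately show ?case
    using span_base[of "x d" "x ` T"] insert.hyps(2)
    by (auto simp: independent_insert)
qed

text \<open>In terms of incidence vectors, this compares an independent set with a set spanning it.\<close>
lemma card_acyclic_le_card_connects:
  assumes "loopless_multigraph ends" "acyclic_edges ends A" "connects ends B"
  shows "card A \<le> card B"
proof -
  obtain x where x: "is_incidence ends x"
    using incidence_exists[OF assms(1)] by blast
  have "x e \<in> span (x ` B)" for e
  proof -
    obtain u v where "x e = axis u 1 - axis v 1"
      using x unfolding is_incidence_def by metis
    then show ?thesis
      using axis_diff_in_span_incidence[OF x, of B u v] assms(3) unfolding connects_def by simp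
  qed
  moreover have "independent (x ` A)" and inj: "inj_on x A"
    using acyclic_imp_independent_incidence[OF x assms(2)] by auto
  ultimately have "card (x ` A) \<le> card (x ` B)"
    using independent_span_bound[of "x ` B" "x ` A"] by auto
  also have "\<dots> \<le> card B"
    by (simp add: card_image_le)
  finally show ?thesis
    using card_image[OF inj] by simp
qed

lemma card_spanning_trees_eq:
  assumes "loopless_multigraph ends" "A \<in> spanning_trees ends" "B \<in> spanning_trees ends"
  shows "card A = card B"
  using card_acyclic_le_card_connects[OF assms(1)] assms(2,3)
  unfolding spanning_trees_def by (simp add: le_antisym)

section \<open>Edge usage vectors as a polytope\<close>

definition usage_vec :: "'e::finite set \<Rightarrow> real ^ 'e" where
  "usage_vec \<gamma> = (\<chi> e. of_bool (e \<in> \<gamma>))"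

lemma inner_usage_vec: "\<rho> \<bullet> usage_vec \<gamma> = (\<Sum>e\<in>\<gamma>. \<rho> $ e)"
proof -
  have "\<rho> \<bullet> usage_vec \<gamma> = (\<Sum>e\<in>UNIV. if e \<in> \<gamma> then \<rho> $ e else 0)"
    unfolding inner_vec_def usage_vec_def by (intro sum.cong) auto
  also have "\<dots> = (\<Sum>e\<in>\<gamma>. \<rho> $ e)"
    by (simp flip: sum.inter_restrict)
  finally show ?thesis .
qed

lemma inj_usage_vec: "inj usage_vec"
  unfolding inj_def usage_vec_def vec_eq_iff by auto

definition usage_polytope :: "'e::finite set set \<Rightarrow> (real ^ 'e) set" where
  "usage_polytope \<Gamma> = convex hull (usage_vec ` \<Gamma>)"

lemma edge_usage_prob_eq_sum:
  "(\<chi> e. edge_usage_prob \<Gamma> \<mu> e) = (\<Sum>\<gamma>\<in>\<Gamma>. pmf \<mu> \<gamma> *\<^sub>R usage_vec \<gamma>)"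
proof -
  have "edge_usage_prob \<Gamma> \<mu> e = (\<Sum>\<gamma>\<in>\<Gamma>. pmf \<mu> \<gamma> * of_bool (e \<in> \<gamma>))" for e
    unfolding edge_usage_prob_def by (rule sum.mono_neutral_cong_left) auto
  then show ?thesis
    by (simp add: vec_eq_iff usage_vec_def)
qed

text \<open>A probability mass function on \<open>\<Gamma>\<close> is a family of coefficients of a convex combination.
  Injectivity of \<open>usage_vec\<close> turns coefficients of vectors back into weights of edge sets.\<close>
lemma feu_feasible_iff_usage_polytope: "feu_feasible \<Gamma> \<eta> \<longleftrightarrow> \<eta> \<in> usage_polytope \<Gamma>"
proof
  assume "feu_feasible \<Gamma> \<eta>"
  then obtain \<mu> where \<mu>: "set_pmf \<mu> \<subseteq> \<Gamma>" "\<eta> = (\<chi> e. edge_usage_prob \<Gamma> \<mu> e)"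
    unfolding feu_feasible_def pmfs_on_def by (auto simp: vec_eq_iff)
  have "(\<Sum>\<gamma>\<in>\<Gamma>. pmf \<mu> \<gamma>) = 1"
    using \<mu>(1) by (intro sum_pmf_eq_1) auto
  then have "(\<Sum>\<gamma>\<in>\<Gamma>. pmf \<mu> \<gamma> *\<^sub>R usage_vec \<gamma>) \<in> usage_polytope \<Gamma>"
    unfolding usage_polytope_def by (intro convex_sum) (auto intro: hull_inc)
  then show "\<eta> \<in> usage_polytope \<Gamma>"
    using \<mu>(2) by (simp add: edge_usage_prob_eq_sum)
next
  assume "\<eta> \<in> usage_polytope \<Gamma>"
  then obtain w where w: "\<And>\<gamma>. \<gamma> \<in> \<Gamma> \<Longrightarrow> 0 \<le> w (usage_vec \<gamma>)" "sum w (usage_vec ` \<Gamma>) = 1"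
      "(\<Sum>x\<in>usage_vec ` \<Gamma>. w x *\<^sub>R x) = \<eta>"
    unfolding usage_polytope_def by (auto simp: convex_hull_finite)
  have inj: "inj_on usage_vec \<Gamma>"
    using inj_usage_vec by (rule inj_on_subset) simp
  define q where "q \<gamma> = (if \<gamma> \<in> \<Gamma> then w (usage_vec \<gamma>) else 0)" for \<gamma>
  have q0: "0 \<le> q \<gamma>" for \<gamma>
    using w(1) by (simp add: q_def)
  have "(\<Sum>\<gamma>\<in>UNIV. q \<gamma>) = (\<Sum>\<gamma>\<in>\<Gamma>. w (usage_vec \<gamma>))"
    by (rule sum.mono_neutral_cong_right) (auto simp: q_def)
  also have "\<dots> = 1"
    using w(2) by (simp add: sum.reindex[OF inj])
  finally have "(\<integral>\<^sup>+ \<gamma>. ennreal (q \<gamma>) \<partial>count_space UNIV) = 1"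
    by (simp add: nn_integral_count_space_finite sum_ennreal q0)
  then have pmf: "pmf (embed_pmf q) \<gamma> = q \<gamma>" for \<gamma>
    by (intro pmf_embed_pmf q0)
  have "set_pmf (embed_pmf q) \<subseteq> \<Gamma>"
    by (auto simp: set_pmf_eq pmf q_def)
  moreover have "(\<Sum>\<gamma>\<in>\<Gamma>. q \<gamma> *\<^sub>R usage_vec \<gamma>) = \<eta>"
    using w(3) by (simp add: sum.reindex[OF inj] q_def)
  then have "(\<chi> e. edge_usage_prob \<Gamma> (embed_pmf q) e) = \<eta>"
    by (simp add: edge_usage_prob_eq_sum pmf)
  ultimately show "feu_feasible \<Gamma> \<eta>"
    unfolding feu_feasible_def pmfs_on_def by (auto simp: vec_eq_iff)
qed

lemma usage_polytope_compact: "compact (usage_polytope \<Gamma>)"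
  unfolding usage_polytope_def by (intro finite_imp_compact_convex_hull) simp

lemma usage_polytope_convex: "convex (usage_polytope \<Gamma>)"
  unfolding usage_polytope_def by simp

lemma usage_vec_in_polytope: "\<gamma> \<in> \<Gamma> \<Longrightarrow> usage_vec \<gamma> \<in> usage_polytope \<Gamma>"
  unfolding usage_polytope_def by (auto intro: hull_inc)

lemma usage_polytope_subset:
  "convex S \<Longrightarrow> (\<And>\<gamma>. \<gamma> \<in> \<Gamma> \<Longrightarrow> usage_vec \<gamma> \<in> S) \<Longrightarrow> usage_polytope \<Gamma> \<subseteq> S"
  unfolding usage_polytope_def by (intro hull_minimal) auto

lemma usage_polytope_nonneg:
  assumes "p \<in> usage_polytope \<Gamma>"
  shows "0 \<le> p $ e"
proof -
  have "convex {x :: real ^ 'a. axis e 1 \<bullet> x \<ge> 0}"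
    by (rule convex_halfspace_ge)
  then have "usage_polytope \<Gamma> \<subseteq> {x. axis e 1 \<bullet> x \<ge> 0}"
    by (rule usage_polytope_subset) (simp add: inner_axis' usage_vec_def)
  then show ?thesis
    using assms by (auto simp: inner_axis')
qed

section \<open>Blocking duality\<close>

lemma adm_sets_iff:
  "\<rho> \<in> adm_sets \<Gamma> \<longleftrightarrow> (\<forall>e. 0 \<le> \<rho> $ e) \<and> (\<forall>\<gamma>\<in>\<Gamma>. 1 \<le> \<rho> \<bullet> usage_vec \<gamma>)"
  by (simp add: adm_sets_def inner_usage_vec)

lemma adm_vecs_iff: "\<eta> \<in> adm_vecs F \<longleftrightarrow> (\<forall>e. 0 \<le> \<eta> $ e) \<and> (\<forall>\<rho>\<in>F. 1 \<le> \<rho> \<bullet> \<eta>)"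
  by (simp add: adm_vecs_def inner_vec_def)

lemma adm_sets_eq_Inter:
  "adm_sets \<Gamma> = (\<Inter>e. {\<rho>. axis e 1 \<bullet> \<rho> \<ge> 0}) \<inter> (\<Inter>\<gamma>\<in>\<Gamma>. {\<rho>. usage_vec \<gamma> \<bullet> \<rho> \<ge> 1})"
  by (auto simp: adm_sets_iff inner_axis' inner_commute[of "usage_vec _"])

lemma adm_sets_closed: "closed (adm_sets \<Gamma>)"
  unfolding adm_sets_eq_Inter by (intro closed_Int closed_INT ballI closed_halfspace_ge)

lemma adm_sets_convex: "convex (adm_sets \<Gamma>)"
  unfolding adm_sets_eq_Inter by (intro convex_Int convex_INT convex_halfspace_ge)

lemma fulkerson_dual_subset_adm_sets: "fulkerson_dual \<Gamma> \<subseteq> adm_sets \<Gamma>"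
  by (auto simp: fulkerson_dual_def extreme_point_of_def)

text \<open>For \<open>c > 0\<close> the region is a simplex with vertices at the origin and on the axes.\<close>
lemma bounded_nonneg_inner_le:
  fixes w :: "real ^ 'e::finite"
  assumes "\<And>e. 0 < w $ e"
  shows "bounded {x. (\<forall>e. 0 \<le> x $ e) \<and> w \<bullet> x \<le> c}"
proof -
  have "x \<in> cbox 0 (\<chi> e. c / w $ e)" if x: "\<forall>e. 0 \<le> x $ e" "w \<bullet> x \<le> c" for x
  proof -
    have "x $ e \<le> c / w $ e" for e
    proof -
      have "w $ e * x $ e \<le> (\<Sum>e\<in>UNIV. w $ e * x $ e)"
        using assms x(1) by (intro member_le_sum) (auto simp: less_imp_le)
      also have "\<dots> \<le> c"
        using x(2) by (simp add: inner_vec_def)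
      finally show ?thesis
        using assms[of e] by (simp add: field_simps)
    qed
    then show ?thesis
      using x(1) by (simp add: mem_box_cart)
  qed
  then have "{x. (\<forall>e. 0 \<le> x $ e) \<and> w \<bullet> x \<le> c} \<subseteq> cbox 0 (\<chi> e. c / w $ e)"
    by blast
  then show ?thesis
    using bounded_cbox bounded_subset by blast
qed

text \<open>For strictly positive weights the minimizers form a nonempty compact face, and its
  extreme points are extreme points of the whole polyhedron.\<close>
lemma fulkerson_dual_minimizes:
  fixes w :: "real ^ 'e::finite"
  assumes w: "\<And>e. 0 < w $ e" and \<rho>: "\<rho> \<in> adm_sets \<Gamma>"
  shows "\<exists>\<sigma>\<in>fulkerson_dual \<Gamma>. w \<bullet> \<sigma> \<le> w \<bullet> \<rho>"
proof -
  let ?A = "adm_sets \<Gamma>"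
  have compact_sub: "compact (?A \<inter> {x. w \<bullet> x \<le> c})" for c
  proof (unfold compact_eq_bounded_closed, intro conjI)
    have "?A \<inter> {x. w \<bullet> x \<le> c} \<subseteq> {x. (\<forall>e. 0 \<le> x $ e) \<and> w \<bullet> x \<le> c}"
      by (auto simp: adm_sets_iff)
    then show "bounded (?A \<inter> {x. w \<bullet> x \<le> c})"
      using bounded_nonneg_inner_le[OF w] bounded_subset by blast
    show "closed (?A \<inter> {x. w \<bullet> x \<le> c})"
      by (intro closed_Int adm_sets_closed closed_halfspace_le)
  qed
  have "?A \<inter> {x. w \<bullet> x \<le> w \<bullet> \<rho>} \<noteq> {}"
    using \<rho> by auto
  moreover have "continuous_on (?A \<inter> {x. w \<bullet> x \<le> w \<bullet> \<rho>}) (\<lambda>x. w \<bullet> x)"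
    by (intro continuous_intros)
  ultimately obtain m where m: "m \<in> ?A" "w \<bullet> m \<le> w \<bullet> \<rho>"
    and least: "\<And>x. x \<in> ?A \<Longrightarrow> w \<bullet> x \<le> w \<bullet> \<rho> \<Longrightarrow> w \<bullet> m \<le> w \<bullet> x"
    using continuous_attains_inf[OF compact_sub] by blast
  have min: "w \<bullet> m \<le> w \<bullet> x" if "x \<in> ?A" for x
    using least[OF that] m(2) by linarith
  let ?F = "?A \<inter> {x. w \<bullet> x = w \<bullet> m}"
  have face: "?F face_of ?A"
    using adm_sets_convex min by (rule face_of_Int_supporting_hyperplane_ge)
  have "?F = ?A \<inter> {x. w \<bullet> x \<le> w \<bullet> m}"
    using min by (auto intro: antisym)
  then have "compact ?F"
    using compact_sub by simp
  moreover have "convex ?F"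
    by (intro convex_Int adm_sets_convex convex_hyperplane)
  moreover have "?F \<noteq> {}"
    using m(1) by blast
  ultimately obtain \<sigma> where \<sigma>: "\<sigma> extreme_point_of ?F"
    using extreme_point_exists_convex by blast
  then have "\<sigma> extreme_point_of ?A" "\<sigma> \<in> ?F"
    using extreme_point_of_face[OF face] by blast+
  then show ?thesis
    using m(2) by (auto simp: fulkerson_dual_def)
qed

text \<open>A density \<open>\<eta>\<close> may vanish on some edges, and then its sublevel sets need not be bounded.
  Adding a small positive constant to all coordinates makes \<open>fulkerson_dual_minimizes\<close>
  applicable, and the constant is then sent to zero.\<close>
lemma adm_vecs_fulkerson_dual:
  "adm_vecs (fulkerson_dual \<Gamma>) = adm_vecs (adm_sets \<Gamma>)"
proof (intro set_eqI iffI)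
  fix \<eta> :: "real ^ 'a"
  assume "\<eta> \<in> adm_vecs (adm_sets \<Gamma>)"
  then show "\<eta> \<in> adm_vecs (fulkerson_dual \<Gamma>)"
    using fulkerson_dual_subset_adm_sets by (auto simp: adm_vecs_iff)
next
  fix \<eta> :: "real ^ 'a"
  assume \<eta>: "\<eta> \<in> adm_vecs (fulkerson_dual \<Gamma>)"
  have "1 \<le> \<rho> \<bullet> \<eta>" if \<rho>: "\<rho> \<in> adm_sets \<Gamma>" for \<rho>
  proof (rule field_le_epsilon)
    fix \<epsilon> :: real
    assume "0 < \<epsilon>"
    define s where "s = (1 :: real ^ 'a) \<bullet> \<rho>"
    have s: "0 \<le> s"
      using \<rho> by (auto simp: s_def inner_vec_def adm_sets_iff intro: sum_nonneg)
    \<comment> \<open>Shifting \<open>\<eta>\<close> by \<open>\<delta>\<close> changes its pairing with \<open>\<rho>\<close> by \<open>\<delta> * s\<close>; adding 1 to \<open>s\<close>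
      avoids division by zero when \<open>\<rho>\<close> vanishes.\<close>
    define \<delta> where "\<delta> = \<epsilon> / (s + 1)"
    have \<delta>: "0 < \<delta>" "\<delta> * s \<le> \<epsilon>"
      using s \<open>0 < \<epsilon>\<close> by (auto simp: \<delta>_def field_simps)
    define w where "w = \<eta> + \<delta> *\<^sub>R 1"
    have "0 < w $ e" for e
      using \<eta> \<delta>(1) by (simp add: w_def adm_vecs_iff add_nonneg_pos)
    then obtain \<sigma> where \<sigma>: "\<sigma> \<in> fulkerson_dual \<Gamma>" "w \<bullet> \<sigma> \<le> w \<bullet> \<rho>"
      using fulkerson_dual_minimizes[OF _ \<rho>] by blast
    have "1 \<le> \<eta> \<bullet> \<sigma>"
      using \<eta> \<sigma>(1) by (simp add: adm_vecs_iff inner_commute[of \<eta>])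
    also have "0 \<le> (1 :: real ^ 'a) \<bullet> \<sigma>"
      using \<sigma>(1) fulkerson_dual_subset_adm_sets[of \<Gamma>]
      by (auto simp: inner_vec_def adm_sets_iff intro!: sum_nonneg)
    then have "\<eta> \<bullet> \<sigma> \<le> w \<bullet> \<sigma>"
      using \<delta>(1) by (simp add: w_def inner_add_left)
    also have "\<dots> \<le> w \<bullet> \<rho>"
      by (rule \<sigma>(2))
    also have "\<dots> \<le> \<rho> \<bullet> \<eta> + \<epsilon>"
      using \<delta>(2) by (simp add: w_def inner_add_left s_def inner_commute[of \<eta>])
    finally show "1 \<le> \<rho> \<bullet> \<eta> + \<epsilon>" .
  qed
  then show "\<eta> \<in> adm_vecs (adm_sets \<Gamma>)"
    using \<eta> by (simp add: adm_vecs_iff)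
qed

lemma usage_polytope_subset_adm_vecs:
  "usage_polytope \<Gamma> \<subseteq> adm_vecs (fulkerson_dual \<Gamma>)"
proof
  fix p :: "real ^ 'a"
  assume p: "p \<in> usage_polytope \<Gamma>"
  have "1 \<le> \<rho> \<bullet> p" if "\<rho> \<in> adm_sets \<Gamma>" for \<rho>
  proof -
    have "usage_polytope \<Gamma> \<subseteq> {x. \<rho> \<bullet> x \<ge> 1}"
      using that by (intro usage_polytope_subset convex_halfspace_ge) (auto simp: adm_sets_iff)
    then show ?thesis
      using p by auto
  qed
  then show "p \<in> adm_vecs (fulkerson_dual \<Gamma>)"
    using p usage_polytope_nonneg unfolding adm_vecs_fulkerson_dual by (auto simp: adm_vecs_iff)
qed

text \<open>If no point of the polytope lies below \<open>\<eta>\<close>, a hyperplane separates the polytope from the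
  orthant of vectors below \<open>\<eta>\<close>. Its normal vector is nonnegative because the orthant is unbounded
  downwards, and after scaling it is a density that is admissible for \<open>\<Gamma>\<close> but pairs with \<open>\<eta>\<close> to
  less than one.\<close>
lemma adm_vecs_fulkerson_dual_dominates:
  assumes "\<Gamma> \<noteq> {}" and \<eta>: "\<eta> \<in> adm_vecs (fulkerson_dual \<Gamma>)"
  shows "\<exists>p\<in>usage_polytope \<Gamma>. \<forall>e. p $ e \<le> \<eta> $ e"
proof (rule ccontr)
  assume neg: "\<not> ?thesis"
  have \<eta>0: "0 \<le> \<eta> $ e" for e
    using \<eta> by (simp add: adm_vecs_iff)
  define L :: "(real ^ 'a) set" where "L = (\<Inter>e. {x. axis e 1 \<bullet> x \<le> \<eta> $ e})"
  have L_iff: "x \<in> L \<longleftrightarrow> (\<forall>e. x $ e \<le> \<eta> $ e)" for x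
    by (simp add: L_def inner_axis')
  have "closed L"
    unfolding L_def by (intro closed_INT ballI closed_halfspace_le)
  moreover have "convex L"
    unfolding L_def by (intro convex_INT convex_halfspace_le)
  moreover have "L \<inter> usage_polytope \<Gamma> = {}"
    using neg by (auto simp: L_iff)
  moreover have "usage_polytope \<Gamma> \<noteq> {}"
    using assms(1) usage_vec_in_polytope by blast
  ultimately obtain a b where below: "\<And>x. x \<in> L \<Longrightarrow> a \<bullet> x < b"
    and above: "\<And>x. x \<in> usage_polytope \<Gamma> \<Longrightarrow> b < a \<bullet> x"
    using separating_hyperplane_closed_compact[of L "usage_polytope \<Gamma>"]
      usage_polytope_compact usage_polytope_convex by blast
  have a_\<eta>: "a \<bullet> \<eta> < b"
    by (rule below) (simp add: L_iff)
  have a0: "0 \<le> a $ e" for e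
  proof (rule ccontr)
    assume "\<not> 0 \<le> a $ e"
    then have neg: "a $ e < 0" by simp
    \<comment> \<open>Walking down from \<open>\<eta>\<close> in direction \<open>e\<close> by this amount reaches the hyperplane.\<close>
    define t where "t = (b - a \<bullet> \<eta>) / (- a $ e)"
    have "0 \<le> t"
      using neg a_\<eta> by (simp add: t_def divide_nonneg_neg)
    then have "\<eta> - t *\<^sub>R axis e 1 \<in> L"
      by (simp add: L_iff axis_def)
    then have "a \<bullet> (\<eta> - t *\<^sub>R axis e 1) < b"
      by (rule below)
    moreover have "t * a $ e = a \<bullet> \<eta> - b"
      using neg by (simp add: t_def)
    ultimately show False
      by (simp add: inner_diff_right inner_axis)
  qed
  have "0 \<le> a \<bullet> \<eta>"
    using a0 \<eta>0 by (simp add: inner_vec_def sum_nonneg)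
  then have b: "0 < b"
    using a_\<eta> by simp
  have "(1 / b) *\<^sub>R a \<in> adm_sets \<Gamma>"
    using a0 b above[OF usage_vec_in_polytope] by (auto simp: adm_sets_iff field_simps less_imp_le)
  then have "1 \<le> ((1 / b) *\<^sub>R a) \<bullet> \<eta>"
    using \<eta> unfolding adm_vecs_fulkerson_dual adm_vecs_iff by blast
  then show False
    using a_\<eta> b by (simp add: field_simps)
qed

section \<open>The point of least norm\<close>

lemma sum_squares_eq_inner: "(\<Sum>e\<in>UNIV. (x $ e)\<^sup>2) = x \<bullet> (x :: real ^ 'e::finite)"
  by (simp add: inner_vec_def power2_eq_square)

lemma edge_var_eq:
  fixes x :: "real ^ 'e::finite"
  shows "edge_var x = (x \<bullet> x) / real CARD('e) - ((\<Sum>e\<in>UNIV. x $ e) / real CARD('e))\<^sup>2"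
  by (simp add: edge_var_def edge_mean_def sum_squares_eq_inner)

text \<open>The point of least norm is the nearest-point projection of the origin.\<close>
lemma least_norm_exists:
  fixes S :: "'a::euclidean_space set"
  assumes "compact S" "convex S" "S \<noteq> {}"
  shows "\<exists>z\<in>S. \<forall>x\<in>S. z \<bullet> z \<le> x \<bullet> x \<and> (x \<bullet> x \<le> z \<bullet> z \<longrightarrow> x = z)"
proof -
  obtain z where z: "z \<in> S" and min: "\<And>x. x \<in> S \<Longrightarrow> dist 0 z \<le> dist 0 x"
    using distance_attains_inf[OF compact_imp_closed[OF assms(1)] assms(3), of 0] by blast
  have le: "x \<bullet> x \<le> y \<bullet> y \<longleftrightarrow> dist 0 x \<le> dist 0 y" for x y :: 'a
    by (simp add: norm_le)
  have "x = z" if "x \<in> S" "x \<bullet> x \<le> z \<bullet> z" for x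
  proof (rule any_closest_point_unique[OF assms(2) compact_imp_closed[OF assms(1)] that(1) z])
    show "\<forall>y\<in>S. dist 0 x \<le> dist 0 y"
      using that(2) min le by (meson order_trans)
    show "\<forall>y\<in>S. dist 0 z \<le> dist 0 y"
      using min by blast
  qed
  then show ?thesis
    using z min le by blast
qed

lemma is_arg_min_iff_unique:
  fixes f :: "'a \<Rightarrow> 'b::linorder"
  assumes "P z" and "\<And>x. P x \<Longrightarrow> f z \<le> f x" and "\<And>x. P x \<Longrightarrow> f x \<le> f z \<Longrightarrow> x = z"
  shows "is_arg_min f P x \<longleftrightarrow> x = z"
  using assms unfolding is_arg_min_linorder by blast

lemma inner_self_mono:
  fixes p \<eta> :: "real ^ 'e::finite"
  assumes "\<And>e. 0 \<le> p $ e" "\<And>e. p $ e \<le> \<eta> $ e"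
  shows "p \<bullet> p \<le> \<eta> \<bullet> \<eta>" and "\<eta> \<bullet> \<eta> \<le> p \<bullet> p \<Longrightarrow> \<eta> = p"
proof -
  have le: "(p $ e)\<^sup>2 \<le> (\<eta> $ e)\<^sup>2" for e
    using assms by (intro power_mono)
  then show *: "p \<bullet> p \<le> \<eta> \<bullet> \<eta>"
    unfolding sum_squares_eq_inner[symmetric] by (intro sum_mono)
  assume "\<eta> \<bullet> \<eta> \<le> p \<bullet> p"
  then have "(\<Sum>e\<in>UNIV. (\<eta> $ e)\<^sup>2 - (p $ e)\<^sup>2) = 0"
    using * by (simp add: sum_subtractf sum_squares_eq_inner)
  then have "(\<eta> $ e)\<^sup>2 = (p $ e)\<^sup>2" for e
    using le by (subst (asm) sum_nonneg_eq_0_iff) auto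
  moreover have "0 \<le> \<eta> $ e" for e
    using assms[of e] by simp
  ultimately show "\<eta> = p"
    using assms(1) by (simp add: vec_eq_iff)
qed

theorem theorem4p3:
  fixes ends :: "'e::finite \<Rightarrow> 'v::finite set"
  assumes "loopless_multigraph ends"
    and "connects ends UNIV"
  shows "\<exists>\<eta>star.
    (\<forall>\<eta>. is_extremal_density (fulkerson_dual (spanning_trees ends)) \<eta> \<longleftrightarrow> \<eta> = \<eta>star) \<and>
    (\<forall>\<eta>. is_feu_solution (spanning_trees ends) \<eta> \<longleftrightarrow> \<eta> = \<eta>star)"
proof -
  let ?\<Gamma> = "spanning_trees ends"
  let ?P = "usage_polytope ?\<Gamma>"
  obtain T where T: "T \<in> ?\<Gamma>"
    using spanning_trees_nonempty[OF assms] by blast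
  have "?P \<noteq> {}"
    using usage_vec_in_polytope[OF T] by blast
  then obtain z where z: "z \<in> ?P" and least: "\<And>x. x \<in> ?P \<Longrightarrow> z \<bullet> z \<le> x \<bullet> x"
    and unique: "\<And>x. x \<in> ?P \<Longrightarrow> x \<bullet> x \<le> z \<bullet> z \<Longrightarrow> x = z"
    using least_norm_exists[OF usage_polytope_compact usage_polytope_convex] by metis
  have "is_extremal_density (fulkerson_dual ?\<Gamma>) \<eta> \<longleftrightarrow> \<eta> = z" for \<eta>
    unfolding is_extremal_density_def sum_squares_eq_inner
  proof (rule is_arg_min_iff_unique)
    show "z \<in> adm_vecs (fulkerson_dual ?\<Gamma>)"
      using z usage_polytope_subset_adm_vecs by blast
  next
    fix x
    assume "x \<in> adm_vecs (fulkerson_dual ?\<Gamma>)"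
    then obtain p where p: "p \<in> ?P" "\<And>e. p $ e \<le> x $ e"
      using adm_vecs_fulkerson_dual_dominates T by blast
    note mono = inner_self_mono[OF usage_polytope_nonneg[OF p(1)] p(2)]
    show "z \<bullet> z \<le> x \<bullet> x"
      using least[OF p(1)] mono(1) by simp
    show "x = z" if "x \<bullet> x \<le> z \<bullet> z"
      using mono that least[OF p(1)] unique[OF p(1)] by simp
  qed
  moreover have "is_feu_solution ?\<Gamma> \<eta> \<longleftrightarrow> \<eta> = z" for \<eta>
  proof -
    \<comment> \<open>A constant coordinate sum leaves only the norm to vary in the variance.\<close>
    have total: "(\<Sum>e\<in>UNIV. x $ e) = real (card T)" if "x \<in> ?P" for x
    proof -
      have "?P \<subseteq> {x. 1 \<bullet> x = real (card T)}"
        using card_spanning_trees_eq[OF assms(1) _ T]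
        by (intro usage_polytope_subset convex_hyperplane) (auto simp: inner_usage_vec)
      then show ?thesis
        using that by (auto simp: inner_vec_def)
    qed
    have var: "edge_var x \<le> edge_var y \<longleftrightarrow> x \<bullet> x \<le> y \<bullet> y" if "x \<in> ?P" "y \<in> ?P" for x y
      using total[OF that(1)] total[OF that(2)] by (simp add: edge_var_eq divide_le_cancel)
    show ?thesis
      unfolding is_feu_solution_def
      by (rule is_arg_min_iff_unique)
        (use z least unique var in \<open>auto simp: feu_feasible_iff_usage_polytope\<close>)
  qed
  ultimately show ?thesis by blast
qed

end
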